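(* Let $t_0\ge 0$, let $\gamma,\delta,\sigma>0$ be constants, let $A\in\mathbb{R}^{m\times n}$, $b\in\mathbb{R}^m$, and let $f:\mathbb{R}^n\to\mathbb{R}\cup\{+\infty\}$ be proper, convex and continuously differentiable. Let $\beta:[t_0,+\infty)\to(0,+\infty)$ be continuously differentiable with $$\dot\beta(t)\le\frac1\delta\beta(t)\quad\text{for all }t\ge t_0,\qquad \frac1\delta<\gamma,$$ and let $\epsilon:[t_0,+\infty)\to\mathbb{R}^n$ be an integrable function such that $\int_{t_0}^{+\infty}\|\epsilon(t)\|\,dt<+\infty$. Let $(x(t),\lambda(t))$ be a global solution on $[t_0,+\infty)$ of the perturbed dynamical system $$\begin{cases}\ddot x(t)+\gamma\dot x(t)=-\beta(t)\big(\nabla f(x(t))+A^T\lambda(t)+\sigma A^T(Ax(t)-b)\big)+\epsilon(t),\\ \dot\lambda(t)=\beta(t)\big(A(x(t)+\delta\dot x(t))-b\big),\end{cases}$$ and let $(x^*,\lambda^* )\in\Omega$. Then the trajectory $(x(t),\lambda(t))$ is bounded on $[t_0,+\infty)$, and the following hold (all $\mathcal{O}$ estimates being as $t\to+\infty$): (i) $\int_{t_0}^{+\infty}\big(\frac1\delta\beta(t)-\dot\beta(t)\big)\big(\mathcal{L}^\sigma(x(t),\lambda^* )-\mathcal{L}^\sigma(x^*,\lambda(t))\big)\,dt<+\infty$. (ii) $\int_{t_0}^{+\infty}\beta(t)\|Ax(t)-b\|^2\,dt<+\infty$ and $\int_{t_0}^{+\infty}\|\dot x(t)\|^2\,dt<+\infty$.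 (iii) When $\beta(t)\equiv\beta>0$ is constant: $$|f(\bar x(t))-f(x^* )|=\mathcal{O}\left(\frac1t\right),\quad \|A\bar x(t)-b\|=\mathcal{O}\left(\frac1t\right),$$ with $\bar x(t)=\frac{1}{t-t_0}\int_{t_0}^t x(s)\,ds$ for $t>t_0$. (iv) When $\lim_{t\to+\infty}\beta(t)=+\infty$: $$\mathcal{L}(x(t),\lambda^* )-\mathcal{L}(x^*,\lambda(t))=\mathcal{O}\left(\frac1{\beta(t)}\right)\quad\text{and}\quad\|Ax(t)-b\|=\mathcal{O}\left(\frac1{\sqrt{\beta(t)}}\right).$$ (v) Moreover, when $\beta(t)=\mu e^{t/\delta}$ with $\mu>0$: $$|f(x(t))-f(x^* )|=\mathcal{O}\left(\frac1{e^{t/\delta}}\right)\quad\text{and}\quad\|Ax(t)-b\|=\mathcal{O}\left(\frac1{e^{t/\delta}}\right).$$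
   Context: Norms and inner products are Euclidean. Since $f$ is differentiable on $\mathbb{R}^n$, it is finite everywhere and $\nabla f$ is defined on all of $\mathbb{R}^n$. The underlying problem is $\min_x f(x)$ subject to $Ax=b$. Its Lagrangian is $\mathcal{L}(x,\lambda)=f(x)+\langle\lambda,Ax-b\rangle$ and its augmented Lagrangian is $\mathcal{L}^\sigma(x,\lambda)=\mathcal{L}(x,\lambda)+\frac\sigma2\|Ax-b\|^2$, for $(x,\lambda)\in\mathbb{R}^n\times\mathbb{R}^m$. A pair $(x^*,\lambda^* )$ is a saddle point of $\mathcal{L}$ if $\mathcal{L}(x^*,\lambda)\le\mathcal{L}(x^*,\lambda^* )\le\mathcal{L}(x,\lambda^* )$ for all $(x,\lambda)\in\mathbb{R}^n\times\mathbb{R}^m$; equivalently, $-A^T\lambda^*=\nabla f(x^* )$ and $Ax^*=b$. $\Omega$ denotes the set of saddle points of $\mathcal{L}$. A global solution is a pair with $x\in\mathcal{C}^2([t_0,+\infty),\mathbb{R}^n)$ and $\lambda\in\mathcal{C}^1([t_0,+\infty),\mathbb{R}^m)$ satisfying the system for all $t\ge t_0$. Existence of a global solution of the perturbed system is taken for granted (it is a hypothesis here). *)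

theory Defs
  imports "HOL-Analysis.Analysis" "HOL-Library.Landau_Symbols"
begin

definition lagrangian ::
  "(real^'n \<Rightarrow> real) \<Rightarrow> real^'n^'m \<Rightarrow> real^'m \<Rightarrow> real^'n \<Rightarrow> real^'m \<Rightarrow> real" where
  "lagrangian f A b x l = f x + l \<bullet> (A *v x - b)"

definition aug_lagrangian ::
  "(real^'n \<Rightarrow> real) \<Rightarrow> real^'n^'m \<Rightarrow> real^'m \<Rightarrow> real \<Rightarrow> real^'n \<Rightarrow> real^'m \<Rightarrow> real" where
  "aug_lagrangian f A b \<sigma> x l = lagrangian f A b x l + \<sigma> / 2 * (norm (A *v x - b))\<^sup>2"

definition saddle_points ::
  "(real^'n \<Rightarrow> real) \<Rightarrow> real^'n^'m \<Rightarrow> real^'m \<Rightarrow> ((real^'n) \<times> (real^'m)) set" where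
  "saddle_points f A b = {(xs, ls). \<forall>x l.
     lagrangian f A b xs l \<le> lagrangian f A b xs ls \<and>
     lagrangian f A b xs ls \<le> lagrangian f A b x ls}"

(* u is C^1 on the closed ray {t0..} with derivative u'; the derivative at t0 is one-sided. *)
definition C1_on_ray ::
  "real \<Rightarrow> (real \<Rightarrow> 'a::real_normed_vector) \<Rightarrow> (real \<Rightarrow> 'a) \<Rightarrow> bool" where
  "C1_on_ray t0 u u' \<longleftrightarrow>
     (\<forall>t\<ge>t0. (u has_vector_derivative u' t) (at t within {t0..})) \<and> continuous_on {t0..} u'"

(* x is C^2 with derivatives x', x'', and l is C^1 with derivative l'; g is the gradient of
   the objective and e the perturbation. *)
definition global_solution ::
  "real \<Rightarrow> real \<Rightarrow> real \<Rightarrow> real \<Rightarrow> (real^'n \<Rightarrow> real^'n) \<Rightarrow> real^'n^'m \<Rightarrow> real^'m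
    \<Rightarrow> (real \<Rightarrow> real) \<Rightarrow> (real \<Rightarrow> real^'n)
    \<Rightarrow> (real \<Rightarrow> real^'n) \<Rightarrow> (real \<Rightarrow> real^'n) \<Rightarrow> (real \<Rightarrow> real^'n)
    \<Rightarrow> (real \<Rightarrow> real^'m) \<Rightarrow> (real \<Rightarrow> real^'m) \<Rightarrow> bool" where
  "global_solution t0 \<gamma> \<delta> \<sigma> g A b \<beta> e x x' x'' l l' \<longleftrightarrow>
     C1_on_ray t0 x x' \<and> C1_on_ray t0 x' x'' \<and> C1_on_ray t0 l l' \<and>
     (\<forall>t\<ge>t0.
        x'' t + \<gamma> *\<^sub>R x' t =
          - (\<beta> t *\<^sub>R (g (x t) + transpose A *v l t + \<sigma> *\<^sub>R (transpose A *v (A *v x t - b)))) + e t \<and>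
        l' t = \<beta> t *\<^sub>R (A *v (x t + \<delta> *\<^sub>R x' t) - b))"

definition time_average :: "real \<Rightarrow> (real \<Rightarrow> 'a::euclidean_space) \<Rightarrow> real \<Rightarrow> 'a" where
  "time_average t0 x t = (1 / (t - t0)) *\<^sub>R integral {t0..t} x"

end

theory Submission
  imports Defs "HOL-Real_Asymp.Real_Asymp"
begin

text \<open>
  Write \<open>h = L\<^sup>\<sigma>(x, \<lambda>\<^sup>*) - L\<^sup>\<sigma>(x\<^sup>*, \<lambda>) \<ge> 0\<close>. Along a trajectory the energy
  \<open>E = \<delta>\<^sup>2\<beta>h + |x - x\<^sup>* + \<delta>x'|\<^sup>2/2 + (\<delta>\<gamma> - 1)|x - x\<^sup>*|\<^sup>2/2 + \<delta>|\<lambda> - \<lambda>\<^sup>*|\<^sup>2/2\<close>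
  satisfies \<open>E' \<le> \<delta>|\<epsilon>||x - x\<^sup>* + \<delta>x'| - D\<close> with
  \<open>D = \<delta>\<^sup>2(\<beta>/\<delta> - \<beta>')h + \<delta>\<sigma>\<beta>|Ax - b|\<^sup>2/2 + \<delta>(\<delta>\<gamma> - 1)|x'|\<^sup>2\<close>: the coupling terms cancel, and
  convexity bounds the rest. The perturbation is at most \<open>\<delta>|\<epsilon>|(E + 1/2)\<close>, so Gronwall makes \<open>E\<close>
  bounded and \<open>D\<close> integrable, which gives boundedness, the integral estimates and \<open>h = O(1/\<beta>)\<close>.
  The sharper feasibility rates come from integrating the dual equation: it says
  \<open>\<lambda>' = \<beta>(Ax - b) + (\<beta>\<delta>(Ax - b))'\<close> for constant \<open>\<beta>\<close> and
  \<open>\<lambda>' = (\<delta>\<beta>(Ax - b))'\<close> for \<open>\<beta> = \<mu> exp(t/\<delta>)\<close>, while \<open>\<lambda>\<close> is bounded.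
\<close>

section \<open>Tangent planes of convex functions\<close>

text \<open>Restricting \<open>f\<close> to the line \<open>p\<close> through \<open>x\<close> and
  \<open>y\<close> reduces this to the one-dimensional tangent inequality at 0, evaluated at
  1.\<close>

lemma convex_on_imp_above_gradient:
  fixes f :: "'a::real_inner \<Rightarrow> real"
  assumes "convex_on UNIV f" and "GDERIV f x :> g"
  shows "f y - f x \<ge> g \<bullet> (y - x)"
proof -
  define p where "p s = x + s *\<^sub>R (y - x)" for s :: real
  have "convex_on UNIV (\<lambda>s. f (p s))"
  proof (rule convex_onI)
    fix t u v :: real
    assume "0 < t" "t < 1"
    then have "f ((1 - t) *\<^sub>R p u + t *\<^sub>R p v) \<le> (1 - t) * f (p u) + t * f (p v)"
      using convex_onD[OF assms(1), of t "p u" "p v"] by simp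
    moreover have "p ((1 - t) *\<^sub>R u + t *\<^sub>R v) = (1 - t) *\<^sub>R p u + t *\<^sub>R p v"
      by (simp add: p_def algebra_simps)
    ultimately show "f (p ((1 - t) *\<^sub>R u + t *\<^sub>R v)) \<le> (1 - t) * f (p u) + t * f (p v)"
      by simp
  qed simp
  moreover have "((\<lambda>s. f (p s)) has_field_derivative g \<bullet> (y - x)) (at 0)"
  proof -
    have "(p has_derivative (\<lambda>s. s *\<^sub>R (y - x))) (at 0)"
      unfolding p_def by (auto intro!: derivative_eq_intros)
    moreover have "(f has_derivative (\<lambda>h. h \<bullet> g)) (at (p 0))"
      using assms(2) by (simp add: gderiv_def p_def)
    ultimately show ?thesis
      using has_derivative_compose[of p "\<lambda>s. s *\<^sub>R (y - x)" 0 UNIV f "\<lambda>h. h \<bullet> g"]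
      by (simp add: has_field_derivative_def inner_commute mult_commute_abs)
  qed
  ultimately have "g \<bullet> (y - x) * (1 - 0) \<le> f (p 1) - f (p 0)"
    by (intro convex_on_imp_above_tangent[where A = UNIV]) auto
  then show ?thesis
    by (simp add: p_def)
qed

section \<open>Integrals over a ray and a Gronwall estimate\<close>

text \<open>Monotone convergence applied to the truncations \<open>h k\<close> of \<open>d\<close>
  to \<open>{a..a + real k}\<close>, whose integrals are bounded by \<open>B\<close>. Since
  \<open>d\<close> is nonnegative, integrability is already absolute.\<close>

lemma absolutely_integrable_on_ray:
  fixes d :: "real \<Rightarrow> real"
  assumes cont: "continuous_on {a..} d"
    and nonneg: "\<And>t. t \<ge> a \<Longrightarrow> 0 \<le> d t"
    and bound: "\<And>t. t \<ge> a \<Longrightarrow> integral {a..t} d \<le> B"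
  shows "d absolutely_integrable_on {a..}"
proof -
  define h where "h k t = (if t \<in> {a..a + real k} then d t else 0)" for k t
  have int: "d integrable_on {a..t}" for t
    by (intro integrable_continuous_real continuous_on_subset[OF cont]) auto
  have inter: "{a..a + real k} \<inter> {a..} = {a..a + real k}" for k
    by auto
  have ih: "h k integrable_on {a..}" and Ih: "integral {a..} (h k) = integral {a..a + real k} d" for k
    unfolding h_def integrable_restrict_Int integral_restrict_Int inter by (rule int refl)+
  have "0 \<le> integral {a..a + real k} d" for k
    using nonneg by (intro integral_nonneg int) auto
  then have "\<bar>integral {a..} (h k)\<bar> \<le> B" for k
    using bound[of "a + real k"] by (simp add: Ih)
  then have "bounded (range (\<lambda>k. integral {a..} (h k)))"
    by (auto simp: bounded_iff)
  moreover have "(\<lambda>k. h k t) \<longlonglongrightarrow> d t" if "t \<in> {a..}" for t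
  proof (rule tendsto_eventually)
    obtain N :: nat where "t - a \<le> real N"
      using real_arch_simple by blast
    then have "\<forall>k\<ge>N. h k t = d t"
      using that by (auto simp: h_def)
    then show "\<forall>\<^sub>F k in sequentially. h k t = d t"
      by (auto simp: eventually_sequentially)
  qed
  moreover have "h k t \<le> h (Suc k) t" if "t \<in> {a..}" for k t
    using that nonneg by (auto simp: h_def)
  ultimately have "d integrable_on {a..}"
    using monotone_convergence_increasing[of h "{a..}" d] ih by blast
  then show ?thesis
    by (intro nonnegative_absolutely_integrable_1) (auto intro: nonneg)
qed

lemma integral_le_integral_ray:
  fixes c :: "real \<Rightarrow> real"
  assumes "c integrable_on {a..}" and "\<And>t. t \<ge> a \<Longrightarrow> 0 \<le> c t"
  shows "integral {a..t} c \<le> integral {a..} c"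
  by (intro integral_subset_le integrable_on_subinterval[OF assms(1)]) (auto intro: assms)

text \<open>A comparison test; continuity of \<open>d\<close> supplies integrability on compact
  intervals. It later separates the summands of an integrable sum of nonnegative terms.\<close>

lemma absolutely_integrable_on_ray_bound:
  fixes d g :: "real \<Rightarrow> real"
  assumes "continuous_on {a..} d" and d: "\<And>t. t \<ge> a \<Longrightarrow> 0 \<le> d t"
    and dg: "\<And>t. t \<ge> a \<Longrightarrow> d t \<le> g t" and g: "g integrable_on {a..}"
  shows "d absolutely_integrable_on {a..}"
proof (rule absolutely_integrable_on_ray[OF assms(1) d])
  fix t assume "t \<ge> a"
  have "integral {a..t} d \<le> integral {a..t} g"
    using dg by (intro integral_le integrable_on_subinterval[OF g]
        integrable_continuous_real continuous_on_subset[OF assms(1)]) auto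
  also have "\<dots> \<le> integral {a..} g"
    using g d dg by (intro integral_le_integral_ray) force+
  finally show "integral {a..t} d \<le> integral {a..} g" .
qed

text \<open>Gronwall's argument first bounds \<open>F\<close> by discarding \<open>d\<close>. With
  that bound in hand, integrating the same differential inequality again controls the integral of
  \<open>d\<close>.\<close>

lemma perturbed_lyapunov:
  fixes F F' c d :: "real \<Rightarrow> real"
  assumes dF: "\<And>t. t \<ge> a \<Longrightarrow> (F has_vector_derivative F' t) (at t within {a..})"
    and F': "\<And>t. t \<ge> a \<Longrightarrow> F' t \<le> c t * F t - d t"
    and F: "\<And>t. t \<ge> a \<Longrightarrow> 0 \<le> F t"
    and d: "\<And>t. t \<ge> a \<Longrightarrow> 0 \<le> d t"
    and c: "\<And>t. t \<ge> a \<Longrightarrow> 0 \<le> c t"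
    and cont: "continuous_on {a..} c" "continuous_on {a..} d"
    and int: "c integrable_on {a..}"
  shows "\<exists>M. \<forall>t\<ge>a. F t \<le> M" and "d absolutely_integrable_on {a..}"
proof -
  define C where "C t = integral {a..t} c" for t
  define I where "I = integral {a..} c"
  define M where "M = exp I * F a"
  have C: "C t \<le> I" for t
    unfolding C_def I_def using int c by (rule integral_le_integral_ray)
  have cont': "continuous_on {a..t} c" "continuous_on {a..t} d" for t
    using cont by (auto elim: continuous_on_subset)
  have dF': "(F has_vector_derivative F' s) (at s within {a..t})" if "s \<in> {a..t}" for s t
    using dF[of s] that by (auto elim: has_vector_derivative_within_subset)
  have M: "F t \<le> M" if "t \<ge> a" for t
  proof -
    \<comment> \<open>The integrating factor \<open>exp (- C s)\<close> absorbs the term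
      \<open>c s * F s\<close>, so that \<open>W\<close> is nonincreasing.\<close>
    define W where "W s = exp (- C s) * F s" for s
    have dW: "(W has_vector_derivative exp (- C s) * (F' s - c s * F s)) (at s within {a..t})"
      if "s \<in> {a..t}" for s
    proof -
      have "(C has_real_derivative c s) (at s within {a..t})"
        unfolding C_def has_real_derivative_iff_has_vector_derivative
        using cont' that by (intro integral_has_vector_derivative) auto
      moreover have "(F has_real_derivative F' s) (at s within {a..t})"
        using dF'[OF that] by (simp add: has_real_derivative_iff_has_vector_derivative)
      ultimately have "(W has_real_derivative exp (- C s) * (F' s - c s * F s)) (at s within {a..t})"
        unfolding W_def by (auto intro!: derivative_eq_intros simp: algebra_simps)
      then show ?thesis
        by (simp add: has_real_derivative_iff_has_vector_derivative)
    qed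
    have "((\<lambda>s. exp (- C s) * (F' s - c s * F s)) has_integral W t - W a) {a..t}"
      using \<open>t \<ge> a\<close> by (intro fundamental_theorem_of_calculus dW) auto
    moreover have "exp (- C s) * (F' s - c s * F s) \<le> 0" if "s \<in> {a..t}" for s
      using F'[of s] d[of s] that by (intro mult_nonneg_nonpos) auto
    ultimately have "W t - W a \<le> 0"
      using has_integral_le[OF _ has_integral_0[of "{a..t}"]] by blast
    then have "F t \<le> exp (C t) * F a"
      by (simp add: W_def C_def exp_minus field_simps)
    also have "\<dots> \<le> M"
      unfolding M_def using C F[of a] by (intro mult_right_mono) auto
    finally show ?thesis .
  qed
  then show "\<exists>M. \<forall>t\<ge>a. F t \<le> M"
    by blast
  show "d absolutely_integrable_on {a..}"
  proof (rule absolutely_integrable_on_ray)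
    fix t assume "t \<ge> a"
    \<comment> \<open>Second pass: \<open>F\<close> is replaced by its bound \<open>M\<close> in the
      inequality for \<open>F'\<close>, and \<open>d\<close> is kept this time.\<close>
    have "(F' has_integral F t - F a) {a..t}"
      using \<open>t \<ge> a\<close> by (intro fundamental_theorem_of_calculus dF') auto
    moreover have "((\<lambda>s. c s * M - d s) has_integral C t * M - integral {a..t} d) {a..t}"
      unfolding C_def
      by (intro has_integral_diff has_integral_mult_left integrable_integral
          integrable_continuous_real cont')
    moreover have "F' s \<le> c s * M - d s" if "s \<in> {a..t}" for s
    proof -
      have "c s * F s \<le> c s * M"
        using that M c by (intro mult_left_mono) auto
      then show ?thesis
        using F'[of s] that by auto
    qed
    ultimately have "F t - F a \<le> C t * M - integral {a..t} d"
      by (rule has_integral_le)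
    moreover have "C t * M \<le> I * M"
      using C F[of a] by (intro mult_right_mono) (auto simp: M_def)
    ultimately show "integral {a..t} d \<le> F a + I * M"
      using F[OF \<open>t \<ge> a\<close>] by linarith
  qed (use d cont in auto)
qed

section \<open>From explicit bounds to Landau symbols\<close>

text \<open>Time averages carry the factor \<open>1 / (t - a)\<close>, which is asymptotically
  equivalent to \<open>1 / t\<close>.\<close>

lemma bigo_inverse_of_shifted_bound:
  fixes u :: "real \<Rightarrow> real"
  assumes "\<And>t. t > a \<Longrightarrow> \<bar>u t\<bar> \<le> K / (t - a)"
  shows "u \<in> O[at_top](\<lambda>t. 1 / t)"
proof -
  have "(\<lambda>t. K / (t - a)) \<in> O[at_top](\<lambda>t. 1 / t)"
    by real_asymp
  moreover have "u \<in> O[at_top](\<lambda>t. K / (t - a))"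
  proof (rule bigoI[where c = 1])
    show "\<forall>\<^sub>F t in at_top. norm (u t) \<le> 1 * norm (K / (t - a))"
      using eventually_gt_at_top[of a]
    proof eventually_elim
      case (elim t)
      show ?case
        using assms[OF elim] unfolding real_norm_def mult_1 by linarith
    qed
  qed
  ultimately show ?thesis
    by (rule landau_o.big_trans[rotated])
qed

lemma bigoI_ray:
  fixes u v :: "real \<Rightarrow> real"
  assumes "\<And>t. t \<ge> a \<Longrightarrow> \<bar>u t\<bar> \<le> K * v t"
  shows "u \<in> O[at_top](v)"
proof (rule bigoI[where c = "\<bar>K\<bar>"])
  show "\<forall>\<^sub>F t in at_top. norm (u t) \<le> \<bar>K\<bar> * norm (v t)"
    using eventually_ge_at_top[of a]
  proof eventually_elim
    case (elim t)
    have "K * v t \<le> \<bar>K\<bar> * \<bar>v t\<bar>"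
      by (metis abs_ge_self abs_mult)
    then show ?case
      using assms[OF elim] unfolding real_norm_def by linarith
  qed
qed

text \<open>Stated with the factor \<open>c / 2\<close> because the quadratic terms of the energy
  have this shape.\<close>

lemma has_vector_derivative_half_norm_squared:
  fixes u :: "real \<Rightarrow> 'a::real_inner"
  assumes "(u has_vector_derivative u') (at t within S)"
  shows "((\<lambda>s. c / 2 * (norm (u s))\<^sup>2) has_vector_derivative c * (u t \<bullet> u')) (at t within S)"
  using bounded_bilinear.has_vector_derivative[OF bounded_bilinear_inner assms assms]
  unfolding power2_norm_eq_inner
  by (auto intro!: derivative_eq_intros simp: inner_commute)

section \<open>The trajectory, the saddle point and the Lagrangian gap\<close>

locale perturbed_primal_dual_trajectory =
  fixes t0 \<gamma> \<delta> \<sigma> :: real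
    and A :: "real^'n^'m" and b :: "real^'m"
    and f :: "real^'n \<Rightarrow> real" and grad_f :: "real^'n \<Rightarrow> real^'n"
    and \<beta> \<beta>' :: "real \<Rightarrow> real"
    and \<epsilon> :: "real \<Rightarrow> real^'n"
    and x x' x'' :: "real \<Rightarrow> real^'n" and l l' :: "real \<Rightarrow> real^'m"
    and xs :: "real^'n" and ls :: "real^'m"
  assumes pos: "\<gamma> > 0" "\<delta> > 0" "\<sigma> > 0"
    and convex: "convex_on UNIV f"
    and grad: "\<And>z. GDERIV f z :> grad_f z"
    and grad_cont: "continuous_on UNIV grad_f"
    and beta_pos: "\<And>t. t \<ge> t0 \<Longrightarrow> \<beta> t > 0"
    and beta_C1: "C1_on_ray t0 \<beta> \<beta>'"
    and beta_growth: "\<And>t. t \<ge> t0 \<Longrightarrow> \<beta>' t \<le> 1 / \<delta> * \<beta> t"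
    and delta_gamma: "1 / \<delta> < \<gamma>"
    and eps: "\<epsilon> absolutely_integrable_on {t0..}"
    and sol: "global_solution t0 \<gamma> \<delta> \<sigma> grad_f A b \<beta> \<epsilon> x x' x'' l l'"
    and saddle: "(xs, ls) \<in> saddle_points f A b"
begin

definition residual :: "real^'n \<Rightarrow> real^'m" where
  "residual z = A *v z - b"

text \<open>This is L(z, ls) - L(xs, m) for every multiplier \<open>m\<close>: feasibility of
  \<open>xs\<close> removes \<open>m\<close>, as \<open>lagrangian_diff\<close> shows. The moving
  multiplier \<open>l t\<close> therefore never enters the gap.\<close>

definition gap :: "real^'n \<Rightarrow> real" where
  "gap z = f z - f xs + ls \<bullet> residual z"

definition aug_gap :: "real^'n \<Rightarrow> real" where
  "aug_gap z = gap z + \<sigma> / 2 * (norm (residual z))\<^sup>2"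

definition grad_aug_gap :: "real^'n \<Rightarrow> real^'n" where
  "grad_aug_gap z = grad_f z + transpose A *v ls + \<sigma> *\<^sub>R (transpose A *v residual z)"

text \<open>The weights are tuned for cancellation: \<open>\<delta>\<^sup>2 * \<beta> t\<close>
  against the gradient paired with \<open>x' t\<close>, \<open>(\<delta> * \<gamma> - 1) / 2\<close>
  against friction, and \<open>\<delta> / 2\<close> against the coupling through
  \<open>A\<close>.\<close>

definition energy :: "real \<Rightarrow> real" where
  "energy t = \<delta>\<^sup>2 * \<beta> t * aug_gap (x t) + 1 / 2 * (norm (x t - xs + \<delta> *\<^sub>R x' t))\<^sup>2 +
     (\<delta> * \<gamma> - 1) / 2 * (norm (x t - xs))\<^sup>2 + \<delta> / 2 * (norm (l t - ls))\<^sup>2"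

definition energy' :: "real \<Rightarrow> real" where
  "energy' t = \<delta>\<^sup>2 * \<beta>' t * aug_gap (x t) + \<delta>\<^sup>2 * \<beta> t * (grad_aug_gap (x t) \<bullet> x' t) +
     (x t - xs + \<delta> *\<^sub>R x' t) \<bullet> (x' t + \<delta> *\<^sub>R x'' t) +
     (\<delta> * \<gamma> - 1) * ((x t - xs) \<bullet> x' t) + \<delta> * ((l t - ls) \<bullet> l' t)"

text \<open>Up to positive constants, the three summands are the integrands of the three integral
  estimates.\<close>

definition dissipation :: "real \<Rightarrow> real" where
  "dissipation t = \<delta>\<^sup>2 * ((1 / \<delta> * \<beta> t - \<beta>' t) * aug_gap (x t)) +
     \<delta> * \<sigma> / 2 * (\<beta> t * (norm (residual (x t)))\<^sup>2) + \<delta> * (\<delta> * \<gamma> - 1) * (norm (x' t))\<^sup>2"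

lemma delta_gamma': "\<delta> * \<gamma> - 1 > 0"
  using delta_gamma pos by (simp add: field_simps)

text \<open>Testing the saddle inequality with the multiplier shifted by the residual
  \<open>A *v xs - b\<close> forces the squared norm of that residual to be at most 0.\<close>

lemma feasible: "A *v xs = b"
proof -
  have "lagrangian f A b xs (ls + (A *v xs - b)) \<le> lagrangian f A b xs ls"
    using saddle by (auto simp: saddle_points_def)
  then have "(A *v xs - b) \<bullet> (A *v xs - b) \<le> 0"
    by (simp add: lagrangian_def inner_add_left)
  then show ?thesis
    using inner_gt_zero_iff[of "A *v xs - b"] by fastforce
qed

lemma residual_eq: "residual z = A *v (z - xs)"
  by (simp add: residual_def matrix_vector_mult_diff_distrib feasible)

lemma lagrangian_diff: "lagrangian f A b z ls - lagrangian f A b xs m = gap z"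
  by (simp add: lagrangian_def gap_def residual_def feasible)

lemma aug_lagrangian_diff: "aug_lagrangian f A b \<sigma> z ls - aug_lagrangian f A b \<sigma> xs m = aug_gap z"
  using lagrangian_diff[of z m] by (simp add: aug_lagrangian_def aug_gap_def residual_def feasible)

lemma gap_nonneg: "gap z \<ge> 0"
proof -
  have "lagrangian f A b xs ls \<le> lagrangian f A b z ls"
    using saddle by (auto simp: saddle_points_def)
  then show ?thesis
    using lagrangian_diff[of z ls] by linarith
qed

lemma gap_le_aug_gap: "gap z \<le> aug_gap z"
  using pos by (simp add: aug_gap_def)

lemma aug_gap_nonneg: "aug_gap z \<ge> 0"
  using gap_nonneg gap_le_aug_gap order_trans by blast

text \<open>As a simp rule it would turn \<open>transpose A *v u\<close> into \<open>u v* A\<close>,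
  away from the form used in the system and in the adjoint identities below.\<close>

declare transpose_matrix_vector [simp del]

lemma
  shows transpose_inner: "(transpose A *v u) \<bullet> w = u \<bullet> (A *v w)"
    and inner_transpose: "w \<bullet> (transpose A *v u) = u \<bullet> (A *v w)"
  by (simp_all add: transpose_matrix_vector dot_lmul_matrix inner_commute[of w])

lemma GDERIV_gap: "GDERIV gap z :> grad_f z + transpose A *v ls"
proof -
  have "(f has_derivative (\<lambda>h. h \<bullet> grad_f z)) (at z)"
    using grad by (simp add: gderiv_def)
  then show ?thesis
    unfolding gderiv_def gap_def residual_def
    by (auto intro!: derivative_eq_intros has_derivative_inner_right
        bounded_linear.has_derivative[OF matrix_vector_mul_bounded_linear]
        simp: inner_add_right inner_transpose)
qed

lemma GDERIV_aug_gap: "GDERIV aug_gap z :> grad_aug_gap z"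
proof -
  have 1: "(gap has_derivative (\<lambda>h. h \<bullet> (grad_f z + transpose A *v ls))) (at z)"
    using GDERIV_gap by (simp add: gderiv_def)
  have 2: "(residual has_derivative (\<lambda>h. A *v h)) (at z)"
    unfolding residual_def
    by (auto intro!: derivative_eq_intros bounded_linear.has_derivative[OF matrix_vector_mul_bounded_linear])
  show ?thesis
    unfolding gderiv_def aug_gap_def grad_aug_gap_def power2_norm_eq_inner
    by (auto intro!: derivative_eq_intros 1 2
        simp: inner_add_right inner_transpose inner_commute[of "A *v _" "residual z"])
qed

text \<open>A convex function plus an affine one.\<close>

lemma convex_gap: "convex_on UNIV gap"
proof (rule convex_onI)
  fix t :: real and u v
  assume t: "0 < t" "t < 1"
  have "f ((1 - t) *\<^sub>R u + t *\<^sub>R v) \<le> (1 - t) * f u + t * f v"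
    using convex_onD[OF convex, of t u v] t by simp
  moreover have "residual ((1 - t) *\<^sub>R u + t *\<^sub>R v) = (1 - t) *\<^sub>R residual u + t *\<^sub>R residual v"
    by (simp add: residual_def matrix_vector_right_distrib matrix_vector_mult_scaleR algebra_simps)
  ultimately show "gap ((1 - t) *\<^sub>R u + t *\<^sub>R v) \<le> (1 - t) * gap u + t * gap v"
    unfolding gap_def by (simp only: inner_add_right inner_scaleR_right) (simp add: algebra_simps)
qed simp

lemma gap_above_gradient: "gap y - gap z \<ge> (grad_f z + transpose A *v ls) \<bullet> (y - z)"
  by (rule convex_on_imp_above_gradient[OF convex_gap GDERIV_gap])

text \<open>Convexity towards \<open>xs\<close>, where the gap vanishes, yields
  \<open>gap z\<close>. The penalty gradient yields \<sigma> times the squared residual, twice what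
  \<open>aug_gap\<close> contains; the surplus half produces the residual term of the
  dissipation.\<close>

lemma grad_aug_gap_bound:
  "grad_aug_gap z \<bullet> (z - xs) \<ge> aug_gap z + \<sigma> / 2 * (norm (residual z))\<^sup>2"
proof -
  have "(grad_f z + transpose A *v ls) \<bullet> (z - xs) \<ge> gap z"
    using gap_above_gradient[where y = xs and z = z]
    by (simp add: gap_def residual_eq algebra_simps)
  moreover have "(transpose A *v residual z) \<bullet> (z - xs) = (norm (residual z))\<^sup>2"
    by (simp add: transpose_inner residual_eq power2_norm_eq_inner)
  ultimately show ?thesis
    by (simp add: grad_aug_gap_def aug_gap_def inner_add_left)
qed

section \<open>The equations of motion and continuity along the trajectory\<close>

text \<open>The primal equation is recentred at the saddle point: splitting \<open>l t\<close> as
  \<open>ls + (l t - ls)\<close> turns the driving force into \<open>grad_aug_gap\<close> plus a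
  coupling term in \<open>l t - ls\<close>.\<close>

lemma
  shows dx: "t \<ge> t0 \<Longrightarrow> (x has_vector_derivative x' t) (at t within {t0..})"
    and dx': "t \<ge> t0 \<Longrightarrow> (x' has_vector_derivative x'' t) (at t within {t0..})"
    and dl: "t \<ge> t0 \<Longrightarrow> (l has_vector_derivative l' t) (at t within {t0..})"
    and dbeta: "t \<ge> t0 \<Longrightarrow> (\<beta> has_vector_derivative \<beta>' t) (at t within {t0..})"
    and primal: "t \<ge> t0 \<Longrightarrow> x'' t = \<epsilon> t - \<gamma> *\<^sub>R x' t -
      \<beta> t *\<^sub>R (grad_aug_gap (x t) + transpose A *v (l t - ls))"
    and dual: "t \<ge> t0 \<Longrightarrow> l' t = \<beta> t *\<^sub>R (residual (x t) + \<delta> *\<^sub>R (A *v x' t))"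
proof -
  show "x'' t = \<epsilon> t - \<gamma> *\<^sub>R x' t - \<beta> t *\<^sub>R (grad_aug_gap (x t) + transpose A *v (l t - ls))"
    if "t \<ge> t0"
  proof -
    have "x'' t + \<gamma> *\<^sub>R x' t =
        - (\<beta> t *\<^sub>R (grad_f (x t) + transpose A *v l t +
          \<sigma> *\<^sub>R (transpose A *v (A *v x t - b)))) + \<epsilon> t"
      using sol that by (auto simp: global_solution_def)
    moreover have "grad_aug_gap (x t) + transpose A *v (l t - ls) =
        grad_f (x t) + transpose A *v l t + \<sigma> *\<^sub>R (transpose A *v (A *v x t - b))"
      by (simp add: grad_aug_gap_def residual_def matrix_vector_mult_diff_distrib)
    ultimately show ?thesis
      by (simp only: eq_diff_eq diff_conv_add_uminus) (simp add: algebra_simps)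
  qed
  show "l' t = \<beta> t *\<^sub>R (residual (x t) + \<delta> *\<^sub>R (A *v x' t))" if "t \<ge> t0"
    using sol that
    by (simp add: global_solution_def residual_def matrix_vector_right_distrib
        matrix_vector_mult_scaleR algebra_simps)
qed (use sol beta_C1 in \<open>auto simp: global_solution_def C1_on_ray_def\<close>)

lemma
  shows cont_x: "continuous_on {t0..} x" and cont_x': "continuous_on {t0..} x'"
    and cont_x'': "continuous_on {t0..} x''" and cont_l: "continuous_on {t0..} l"
    and cont_beta: "continuous_on {t0..} \<beta>" and cont_beta': "continuous_on {t0..} \<beta>'"
  using sol beta_C1 dx dx' dl dbeta
  by (auto simp: global_solution_def C1_on_ray_def intro!: continuous_on_vector_derivative)

lemma cont_residual: "continuous_on {t0..} (\<lambda>t. residual (x t))"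
  unfolding residual_def
  by (intro continuous_intros linear_continuous_on_compose[OF cont_x] matrix_vector_mul_linear)

lemma continuous_gap: "continuous_on UNIV gap"
  using GDERIV_gap by (auto simp: gderiv_def intro!: has_derivative_continuous_on)

lemma cont_gap: "continuous_on {t0..} (\<lambda>t. gap (x t))"
  using continuous_on_compose2[OF continuous_gap cont_x] by simp

lemma cont_aug_gap: "continuous_on {t0..} (\<lambda>t. aug_gap (x t))"
  unfolding aug_gap_def by (intro continuous_intros cont_gap cont_residual)

text \<open>The primal equation, solved for the perturbation, expresses it through continuous
  functions, since \<open>x\<close> is twice continuously differentiable. The Gronwall estimate asks
  for this continuity.\<close>

lemma cont_eps: "continuous_on {t0..} \<epsilon>"
proof -
  have "continuous_on {t0..} (\<lambda>t. grad_f (x t))"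
    using continuous_on_compose2[OF grad_cont cont_x] by simp
  moreover have "continuous_on {t0..} (\<lambda>t. transpose A *v u t)" if "continuous_on {t0..} u" for u
    by (intro linear_continuous_on_compose[OF that] matrix_vector_mul_linear)
  then have "continuous_on {t0..} (\<lambda>t. transpose A *v residual (x t))"
    "continuous_on {t0..} (\<lambda>t. transpose A *v (l t - ls))"
    by (simp_all add: cont_residual continuous_on_diff[OF cont_l continuous_on_const])
  ultimately have "continuous_on {t0..} (\<lambda>t. x'' t + \<gamma> *\<^sub>R x' t +
      \<beta> t *\<^sub>R (grad_aug_gap (x t) + transpose A *v (l t - ls)))"
    unfolding grad_aug_gap_def
    by (intro continuous_intros cont_x' cont_x'' cont_beta cont_l cont_residual)
  then show ?thesis
    by (rule continuous_on_eq) (auto simp: primal)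
qed

section \<open>Decay of the energy\<close>

lemma energy_derivative:
  assumes "t \<ge> t0"
  shows "(energy has_vector_derivative energy' t) (at t within {t0..})"
proof -
  have "(aug_gap has_derivative (\<lambda>h. h \<bullet> grad_aug_gap (x t))) (at (x t))"
    using GDERIV_aug_gap by (simp add: gderiv_def)
  then have "((\<lambda>s. aug_gap (x s)) has_vector_derivative grad_aug_gap (x t) \<bullet> x' t)
      (at t within {t0..})"
    using has_derivative_compose[OF dx[OF assms, unfolded has_vector_derivative_def]]
    by (fastforce simp: has_vector_derivative_def inner_commute)
  note [derivative_intros] = this dx[OF assms] dx'[OF assms] dl[OF assms] dbeta[OF assms]
    has_vector_derivative_half_norm_squared
  show ?thesis
    unfolding energy_def energy'_def
    by (rule derivative_eq_intros refl | simp add: algebra_simps)+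
qed

text \<open>Inserting both equations makes every indefinite term cancel except the one with the
  perturbation, which Cauchy-Schwarz bounds; \<open>grad_aug_gap_bound\<close> then estimates what
  is left of the gradient.\<close>

lemma energy'_bound:
  assumes "t \<ge> t0"
  shows "energy' t \<le> \<delta> * norm (\<epsilon> t) * norm (x t - xs + \<delta> *\<^sub>R x' t) - dissipation t"
proof -
  define y v where "y = x t - xs" and "v = y + \<delta> *\<^sub>R x' t"
  define G m where "G = grad_aug_gap (x t)" and "m = l t - ls"
  have b0: "\<delta> * \<beta> t \<ge> 0"
    using beta_pos[OF assms] pos by simp
  \<comment> \<open>The extrapolation \<open>x t + \<delta> *\<^sub>R x' t\<close> in the dual
    equation is what produces \<open>v\<close> here, the same vector whose square is in the
    energy.\<close>
  have dual': "l' t = \<beta> t *\<^sub>R (A *v v)"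
    using dual[OF assms]
    by (simp add: residual_eq v_def y_def matrix_vector_right_distrib matrix_vector_mult_scaleR)
  have "v \<bullet> (x' t + \<delta> *\<^sub>R x'' t) + (\<delta> * \<gamma> - 1) * (y \<bullet> x' t) + \<delta> * (m \<bullet> l' t) =
      \<delta> * (v \<bullet> \<epsilon> t) - \<delta> * (\<delta> * \<gamma> - 1) * (x' t \<bullet> x' t) - \<delta> * \<beta> t * (v \<bullet> G)"
  proof -
    \<comment> \<open>This cancels the multiplier term that \<open>x'' t\<close> contributes when
      paired with \<open>v\<close>.\<close>
    have "m \<bullet> l' t = \<beta> t * (v \<bullet> (transpose A *v m))"
      by (simp add: dual' inner_transpose)
    \<comment> \<open>After this substitution the products \<open>v \<bullet> x' t\<close> cancel,
      and only a negative multiple of the squared velocity remains.\<close>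
    moreover have y: "y \<bullet> x' t = v \<bullet> x' t - \<delta> * (x' t \<bullet> x' t)"
      by (simp add: v_def inner_add_left)
    ultimately show ?thesis
      unfolding primal[OF assms] G_def[symmetric] m_def[symmetric] y
      by (simp add: inner_diff inner_add_left inner_add_right algebra_simps)
  qed
  \<comment> \<open>The second part cancels the derivative of \<open>aug_gap\<close> along the
    trajectory; the first is bounded below by convexity.\<close>
  moreover have "v \<bullet> G = G \<bullet> y + \<delta> * (G \<bullet> x' t)"
    by (simp add: v_def inner_commute[of _ G] inner_add_right)
  moreover have "energy' t = \<delta>\<^sup>2 * \<beta>' t * aug_gap (x t) + \<delta>\<^sup>2 * \<beta> t * (G \<bullet> x' t) +
      (v \<bullet> (x' t + \<delta> *\<^sub>R x'' t) + (\<delta> * \<gamma> - 1) * (y \<bullet> x' t) + \<delta> * (m \<bullet> l' t))"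
    by (simp add: energy'_def G_def y_def v_def m_def)
  ultimately have "energy' t = \<delta>\<^sup>2 * \<beta>' t * aug_gap (x t) + \<delta> * (v \<bullet> \<epsilon> t) -
      \<delta> * (\<delta> * \<gamma> - 1) * (norm (x' t))\<^sup>2 - \<delta> * \<beta> t * (G \<bullet> y)"
    unfolding power2_norm_eq_inner by (simp add: algebra_simps power2_eq_square)
  moreover have "\<delta> * \<beta> t * (G \<bullet> y) \<ge> \<delta> * \<beta> t * (aug_gap (x t) + \<sigma> / 2 * (norm (residual (x t)))\<^sup>2)"
    using grad_aug_gap_bound[of "x t"] b0 by (intro mult_left_mono) (auto simp: G_def y_def)
  moreover have "\<delta> * (v \<bullet> \<epsilon> t) \<le> \<delta> * norm (\<epsilon> t) * norm v"
    using norm_cauchy_schwarz[of v "\<epsilon> t"] pos by (simp add: mult.commute mult.left_commute)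
  moreover have "dissipation t = \<delta> * \<beta> t * (aug_gap (x t) + \<sigma> / 2 * (norm (residual (x t)))\<^sup>2) -
      \<delta>\<^sup>2 * \<beta>' t * aug_gap (x t) + \<delta> * (\<delta> * \<gamma> - 1) * (norm (x' t))\<^sup>2"
    using pos by (simp add: dissipation_def field_simps power2_eq_square)
  ultimately show ?thesis
    by (simp add: v_def y_def)
qed

text \<open>The signs come from the growth condition on \<beta>, from
  \<open>\<delta> * \<gamma> > 1\<close> and from the saddle point property.\<close>

lemma
  assumes "t \<ge> t0"
  shows dissipation_terms_nonneg: "0 \<le> \<delta>\<^sup>2 * ((1 / \<delta> * \<beta> t - \<beta>' t) * aug_gap (x t))"
      "0 \<le> \<delta> * \<sigma> / 2 * (\<beta> t * (norm (residual (x t)))\<^sup>2)"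
      "0 \<le> \<delta> * (\<delta> * \<gamma> - 1) * (norm (x' t))\<^sup>2"
    and scaled_gap_nonneg: "0 \<le> \<delta>\<^sup>2 * \<beta> t * aug_gap (x t)"
  using beta_pos[OF assms] beta_growth[OF assms] pos delta_gamma' aug_gap_nonneg[of "x t"] by simp_all

lemma dissipation_nonneg: "t \<ge> t0 \<Longrightarrow> 0 \<le> dissipation t"
  unfolding dissipation_def by (intro add_nonneg_nonneg dissipation_terms_nonneg)

lemma cont_dissipation: "continuous_on {t0..} dissipation"
  unfolding dissipation_def
  by (intro continuous_intros cont_beta cont_beta' cont_aug_gap cont_residual cont_x')

lemma energy_components:
  assumes "t \<ge> t0"
  shows "\<delta>\<^sup>2 * \<beta> t * aug_gap (x t) \<le> energy t"
    and "1 / 2 * (norm (x t - xs + \<delta> *\<^sub>R x' t))\<^sup>2 \<le> energy t"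
    and "(\<delta> * \<gamma> - 1) / 2 * (norm (x t - xs))\<^sup>2 \<le> energy t"
    and "\<delta> / 2 * (norm (l t - ls))\<^sup>2 \<le> energy t"
proof -
  have "0 \<le> (\<delta> * \<gamma> - 1) / 2 * (norm (x t - xs))\<^sup>2" "0 \<le> \<delta> / 2 * (norm (l t - ls))\<^sup>2"
    "0 \<le> 1 / 2 * (norm (x t - xs + \<delta> *\<^sub>R x' t))\<^sup>2"
    using delta_gamma' pos by auto
  then show "\<delta>\<^sup>2 * \<beta> t * aug_gap (x t) \<le> energy t"
    "1 / 2 * (norm (x t - xs + \<delta> *\<^sub>R x' t))\<^sup>2 \<le> energy t"
    "(\<delta> * \<gamma> - 1) / 2 * (norm (x t - xs))\<^sup>2 \<le> energy t"
    "\<delta> / 2 * (norm (l t - ls))\<^sup>2 \<le> energy t"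
    unfolding energy_def using scaled_gap_nonneg[OF assms] by linarith+
qed

lemma energy_nonneg: "t \<ge> t0 \<Longrightarrow> 0 \<le> energy t"
  using energy_components(1) scaled_gap_nonneg order_trans by blast

text \<open>Gronwall is applied to \<open>energy t + 1 / 2\<close>: the perturbation enters with the
  norm of \<open>x t - xs + \<delta> *\<^sub>R x' t\<close>, and a number is at most half its square
  plus 1/2, hence here at most the shifted energy.\<close>

lemma energy_bounded: "\<exists>M. \<forall>t\<ge>t0. energy t \<le> M"
  and dissipation_integrable: "dissipation absolutely_integrable_on {t0..}"
proof -
  have dF: "((\<lambda>t. energy t + 1 / 2) has_vector_derivative energy' t) (at t within {t0..})"
    if "t \<ge> t0" for t
    using energy_derivative[OF that] by (auto intro!: derivative_eq_intros)
  have F': "energy' t \<le> \<delta> * norm (\<epsilon> t) * (energy t + 1 / 2) - dissipation t" if "t \<ge> t0" for t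
  proof -
    let ?v = "norm (x t - xs + \<delta> *\<^sub>R x' t)"
    have "0 \<le> (?v - 1)\<^sup>2"
      by simp
    then have "?v \<le> 1 / 2 * ?v\<^sup>2 + 1 / 2"
      by (simp add: power2_diff)
    also have "\<dots> \<le> energy t + 1 / 2"
      using energy_components(2)[OF that] by simp
    finally have "\<delta> * norm (\<epsilon> t) * ?v \<le> \<delta> * norm (\<epsilon> t) * (energy t + 1 / 2)"
      using pos by (intro mult_left_mono) auto
    then show ?thesis
      using energy'_bound[OF that] by linarith
  qed
  have int: "(\<lambda>t. \<delta> * norm (\<epsilon> t)) integrable_on {t0..}"
    using eps by (intro integrable_on_mult_right) (simp add: absolutely_integrable_on_def)
  have cont: "continuous_on {t0..} (\<lambda>t. \<delta> * norm (\<epsilon> t))"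
    by (intro continuous_intros cont_eps)
  have nn: "0 \<le> energy t + 1 / 2" if "t \<ge> t0" for t
    using energy_nonneg[OF that] by simp
  have c: "0 \<le> \<delta> * norm (\<epsilon> t)" for t
    using pos by simp
  note L = perturbed_lyapunov[OF dF F' nn dissipation_nonneg c cont cont_dissipation int]
  from L(1) obtain M where "\<forall>t\<ge>t0. energy t + 1 / 2 \<le> M"
    by blast
  then have "\<forall>t\<ge>t0. energy t \<le> M - 1 / 2"
    by (simp add: algebra_simps)
  then show "\<exists>M. \<forall>t\<ge>t0. energy t \<le> M"
    by blast
  show "dissipation absolutely_integrable_on {t0..}"
    by (rule L(2))
qed

section \<open>Boundedness and integral estimates\<close>

text \<open>Two quadratic summands of the bounded energy, divided by their positive coefficients.
  The common radius \<open>B\<close> also feeds the feasibility rates.\<close>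

lemma trajectory_bound: "\<exists>B. \<forall>t\<ge>t0. norm (x t - xs) \<le> B \<and> norm (l t - ls) \<le> B"
proof -
  obtain M where M: "energy t \<le> M" if "t \<ge> t0" for t
    using energy_bounded by blast
  define B where "B = max (sqrt (2 * M / (\<delta> * \<gamma> - 1))) (sqrt (2 * M / \<delta>))"
  have "norm (x t - xs) \<le> B \<and> norm (l t - ls) \<le> B" if "t \<ge> t0" for t
  proof -
    have "(norm (x t - xs))\<^sup>2 \<le> 2 * M / (\<delta> * \<gamma> - 1)"
      using energy_components(3)[OF that] M[OF that] delta_gamma' by (simp add: pos_le_divide_eq mult.commute)
    moreover have "(norm (l t - ls))\<^sup>2 \<le> 2 * M / \<delta>"
      using energy_components(4)[OF that] M[OF that] pos by (simp add: pos_le_divide_eq mult.commute)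
    ultimately show ?thesis
      unfolding B_def by (intro conjI max.coboundedI1 max.coboundedI2 real_le_rsqrt)
  qed
  then show ?thesis
    by blast
qed

lemma trajectory_bounded: "bounded ((\<lambda>t. (x t, l t)) ` {t0..})"
proof -
  obtain B where B: "norm (x t - xs) \<le> B" "norm (l t - ls) \<le> B" if "t \<ge> t0" for t
    using trajectory_bound by blast
  have "(\<lambda>t. (x t, l t)) ` {t0..} \<subseteq> cball xs B \<times> cball ls B"
    using B by (auto simp: dist_norm norm_minus_commute)
  then show ?thesis
    by (rule bounded_subset[OF bounded_Times[OF bounded_cball bounded_cball]])
qed

lemma dissipation_integrable_on: "dissipation integrable_on {t0..}"
  using dissipation_integrable set_lebesgue_integral_eq_integral(1) by blast

text \<open>Each summand of the dissipation lies between 0 and the integrable total; its positive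
  constant factor is then removed.\<close>

lemma aug_gap_integrable:
  "(\<lambda>t. (1 / \<delta> * \<beta> t - \<beta>' t) * aug_gap (x t)) absolutely_integrable_on {t0..}"
  and residual_integrable: "(\<lambda>t. \<beta> t * (norm (residual (x t)))\<^sup>2) absolutely_integrable_on {t0..}"
  and velocity_integrable: "(\<lambda>t. (norm (x' t))\<^sup>2) absolutely_integrable_on {t0..}"
proof -
  have le: "\<delta>\<^sup>2 * ((1 / \<delta> * \<beta> t - \<beta>' t) * aug_gap (x t)) \<le> dissipation t"
    "\<delta> * \<sigma> / 2 * (\<beta> t * (norm (residual (x t)))\<^sup>2) \<le> dissipation t"
    "\<delta> * (\<delta> * \<gamma> - 1) * (norm (x' t))\<^sup>2 \<le> dissipation t" if "t \<ge> t0" for t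
    unfolding dissipation_def using dissipation_terms_nonneg[OF that] by linarith+
  have "(\<lambda>t. \<delta>\<^sup>2 * ((1 / \<delta> * \<beta> t - \<beta>' t) * aug_gap (x t))) absolutely_integrable_on {t0..}"
    by (rule absolutely_integrable_on_ray_bound[OF _ _ le(1) dissipation_integrable_on])
      (intro continuous_intros cont_beta cont_beta' cont_aug_gap dissipation_terms_nonneg; assumption)+
  then show "(\<lambda>t. (1 / \<delta> * \<beta> t - \<beta>' t) * aug_gap (x t)) absolutely_integrable_on {t0..}"
    using pos by (subst (asm) set_integrable_mult_right_iff) auto
  have "(\<lambda>t. \<delta> * \<sigma> / 2 * (\<beta> t * (norm (residual (x t)))\<^sup>2)) absolutely_integrable_on {t0..}"
    by (rule absolutely_integrable_on_ray_bound[OF _ _ le(2) dissipation_integrable_on])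
      (intro continuous_intros cont_beta cont_residual dissipation_terms_nonneg; assumption)+
  then show "(\<lambda>t. \<beta> t * (norm (residual (x t)))\<^sup>2) absolutely_integrable_on {t0..}"
    using pos by (subst (asm) set_integrable_mult_right_iff) auto
  have "(\<lambda>t. \<delta> * (\<delta> * \<gamma> - 1) * (norm (x' t))\<^sup>2) absolutely_integrable_on {t0..}"
    by (rule absolutely_integrable_on_ray_bound[OF _ _ le(3) dissipation_integrable_on])
      (intro continuous_intros cont_x' dissipation_terms_nonneg; assumption)+
  then show "(\<lambda>t. (norm (x' t))\<^sup>2) absolutely_integrable_on {t0..}"
    using pos delta_gamma' by (subst (asm) set_integrable_mult_right_iff) auto
qed

section \<open>Convergence rates\<close>

lemma aug_gap_rate: "\<exists>K. \<forall>t\<ge>t0. aug_gap (x t) \<le> K / \<beta> t"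
proof -
  obtain M where M: "energy t \<le> M" if "t \<ge> t0" for t
    using energy_bounded by blast
  have "aug_gap (x t) \<le> (M / \<delta>\<^sup>2) / \<beta> t" if "t \<ge> t0" for t
  proof -
    have "\<delta>\<^sup>2 * \<beta> t * aug_gap (x t) \<le> M"
      using energy_components(1)[OF that] M[OF that] by linarith
    then show ?thesis
      using pos beta_pos[OF that] by (simp add: field_simps)
  qed
  then show ?thesis
    by blast
qed

text \<open>The objective error is the nonnegative gap minus \<open>ls \<bullet> residual z\<close>.
  Rates for the gap and for feasibility thus combine into a rate for the objective.\<close>

lemma objective_error: "\<bar>f z - f xs\<bar> \<le> gap z + norm ls * norm (residual z)"
  using Cauchy_Schwarz_ineq2[of ls "residual z"] gap_nonneg[of z]
  unfolding gap_def by linarith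

lemma dresidual:
  "t \<ge> t0 \<Longrightarrow> ((\<lambda>s. residual (x s)) has_vector_derivative A *v x' t) (at t within {t0..})"
  unfolding residual_def
  by (auto intro!: derivative_eq_intros
      bounded_linear.has_vector_derivative[OF matrix_vector_mul_bounded_linear] dx)

lemma x_integrable: "x integrable_on {t0..t}"
  by (intro integrable_continuous_real continuous_on_subset[OF cont_x]) auto

text \<open>The residual is affine, so it commutes with averaging.\<close>

lemma residual_time_average:
  assumes "t > t0"
  shows "((\<lambda>s. residual (x s)) has_integral (t - t0) *\<^sub>R residual (time_average t0 x t)) {t0..t}"
proof -
  have "((\<lambda>s. A *v x s) has_integral A *v integral {t0..t} x) {t0..t}"
    using has_integral_linear[OF integrable_integral[OF x_integrable]
        matrix_vector_mul_bounded_linear[of A]]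
    by (simp add: o_def)
  moreover have "((\<lambda>s. b) has_integral (t - t0) *\<^sub>R b) {t0..t}"
    using has_integral_const_real[of b t0 t] assms by simp
  ultimately have "((\<lambda>s. residual (x s)) has_integral A *v integral {t0..t} x - (t - t0) *\<^sub>R b) {t0..t}"
    unfolding residual_def by (rule has_integral_diff)
  then show ?thesis
    using assms
    by (simp add: residual_def time_average_def matrix_vector_mult_scaleR scaleR_diff_right)
qed

text \<open>Jensen's inequality: the linear term of the tangent plane at the average integrates to zero.\<close>

lemma gap_time_average:
  assumes "t > t0"
  shows "(t - t0) * gap (time_average t0 x t) \<le> integral {t0..t} (\<lambda>s. gap (x s))"
proof -
  define z where "z = time_average t0 x t"
  define g where "g = grad_f z + transpose A *v ls"
  have "((\<lambda>s. x s - z) has_integral integral {t0..t} x - (t - t0) *\<^sub>R z) {t0..t}"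
    using has_integral_const_real[of z t0 t] assms
    by (intro has_integral_diff integrable_integral x_integrable) simp
  moreover have "integral {t0..t} x = (t - t0) *\<^sub>R z"
    using assms by (simp add: z_def time_average_def)
  ultimately have "((\<lambda>s. x s - z) has_integral 0) {t0..t}"
    by simp
  from has_integral_linear[OF this bounded_linear_inner_right[of g]]
  have "((\<lambda>s. g \<bullet> (x s - z)) has_integral 0) {t0..t}"
    by (simp only: o_def inner_zero_right)
  moreover have "((\<lambda>s. gap z) has_integral (t - t0) * gap z) {t0..t}"
    using has_integral_const_real[of "gap z" t0 t] assms by simp
  ultimately have "((\<lambda>s. gap z + g \<bullet> (x s - z)) has_integral (t - t0) * gap z + 0) {t0..t}"
    by (intro has_integral_add)
  moreover have "((\<lambda>s. gap (x s)) has_integral integral {t0..t} (\<lambda>s. gap (x s))) {t0..t}"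
    by (intro integrable_integral integrable_continuous_real continuous_on_subset[OF cont_gap]) auto
  moreover have "gap z + g \<bullet> (x s - z) \<le> gap (x s)" for s
    using gap_above_gradient[where y = "x s" and z = z] by (simp add: g_def)
  ultimately have "(t - t0) * gap z + 0 \<le> integral {t0..t} (\<lambda>s. gap (x s))"
    by (rule has_integral_le)
  then show ?thesis
    by (simp add: z_def)
qed

text \<open>For constant \<beta> the dual equation exhibits the residual as the derivative of a
  bounded function, so its integral stays bounded. The gap is integrable because the weight in the
  first integral estimate becomes constant, and Jensen's inequality passes to the average.\<close>

lemma ergodic_rates:
  assumes "c > 0" and const: "\<And>t. t \<ge> t0 \<Longrightarrow> \<beta> t = c"
  shows "\<exists>K. \<forall>t>t0. norm (residual (time_average t0 x t)) \<le> K / (t - t0)"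
    and "\<exists>K. \<forall>t>t0. gap (time_average t0 x t) \<le> K / (t - t0)"
proof -
  \<comment> \<open>An antiderivative of the residual, read off from the dual equation divided by
    \<open>c\<close>.\<close>
  define G where "G t = (1 / c) *\<^sub>R l t - \<delta> *\<^sub>R residual (x t)" for t
  have dG: "(G has_vector_derivative residual (x s)) (at s within {t0..})" if "s \<ge> t0" for s
    unfolding G_def using dresidual[OF that] dl[OF that] dual[OF that] const[OF that] \<open>c > 0\<close>
    by (auto intro!: derivative_eq_intros simp: algebra_simps)
  obtain B where B: "norm (x t - xs) \<le> B" "norm (l t - ls) \<le> B" if "t \<ge> t0" for t
    using trajectory_bound by blast
  \<comment> \<open>The factors \<open>2 * B\<close> come from comparing times \<open>t\<close> and
    \<open>t0\<close> through the saddle point.\<close>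
  define K where "K = (1 / c) * (2 * B) + \<delta> * (onorm ((*v) A) * (2 * B))"
  have "norm (residual (time_average t0 x t)) \<le> K / (t - t0)" if "t > t0" for t
  proof -
    have "((\<lambda>s. residual (x s)) has_integral G t - G t0) {t0..t}"
      using that by (intro fundamental_theorem_of_calculus has_vector_derivative_within_subset[OF dG]) auto
    with residual_time_average[OF that]
    have "(t - t0) *\<^sub>R residual (time_average t0 x t) = G t - G t0"
      by (rule has_integral_unique)
    also have "\<dots> = (1 / c) *\<^sub>R (l t - l t0) - \<delta> *\<^sub>R (A *v (x t - x t0))"
      by (simp add: G_def residual_def matrix_vector_mult_diff_distrib algebra_simps)
    also have "norm \<dots> \<le> (1 / c) * norm (l t - l t0) + \<delta> * norm (A *v (x t - x t0))"
      using norm_triangle_ineq4[of "(1 / c) *\<^sub>R (l t - l t0)" "\<delta> *\<^sub>R (A *v (x t - x t0))"]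
        \<open>c > 0\<close> pos by simp
    also have "\<dots> \<le> K"
    proof -
      have "norm (l t - l t0) \<le> 2 * B" "norm (x t - x t0) \<le> 2 * B"
        using B[of t] B[of t0] that norm_triangle_ineq4[of "l t - ls" "l t0 - ls"]
          norm_triangle_ineq4[of "x t - xs" "x t0 - xs"] by auto
      moreover have "norm (A *v (x t - x t0)) \<le> onorm ((*v) A) * norm (x t - x t0)"
        by (intro onorm matrix_vector_mul_bounded_linear)
      moreover have "onorm ((*v) A) * norm (x t - x t0) \<le> onorm ((*v) A) * (2 * B)"
        using calculation(2) by (intro mult_left_mono onorm_pos_le matrix_vector_mul_bounded_linear)
      ultimately show ?thesis
        unfolding K_def using \<open>c > 0\<close> pos by (intro add_mono mult_left_mono) auto
    qed
    finally have "(t - t0) * norm (residual (time_average t0 x t)) \<le> K"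
      using that by simp
    then show ?thesis
      using that by (simp add: pos_le_divide_eq mult.commute)
  qed
  then show "\<exists>K. \<forall>t>t0. norm (residual (time_average t0 x t)) \<le> K / (t - t0)"
    by blast
  \<comment> \<open>The interval to the right of \<open>t\<close> lies in the ray even for
    \<open>t = t0\<close>, so uniqueness of one-sided derivatives covers the endpoint.\<close>
  have "\<beta>' t = 0" if "t \<ge> t0" for t
  proof (rule vector_derivative_unique_within_closed_interval)
    show "t < t + 1" "t \<in> cbox t (t + 1)"
      by auto
    have sub: "cbox t (t + 1) \<subseteq> {t0..}"
      using that by auto
    show "(\<beta> has_vector_derivative \<beta>' t) (at t within cbox t (t + 1))"
      by (rule has_vector_derivative_within_subset[OF dbeta[OF that] sub])
    show "(\<beta> has_vector_derivative 0) (at t within cbox t (t + 1))"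
      by (rule has_vector_derivative_transform[where f = "\<lambda>_. c"]) (use const that in auto)
  qed
  then have "(\<lambda>t. c / \<delta> * aug_gap (x t)) integrable_on {t0..}"
    using const by (intro integrable_eq[OF set_lebesgue_integral_eq_integral(1)[OF aug_gap_integrable]]) simp
  then have int: "(\<lambda>t. aug_gap (x t)) integrable_on {t0..}"
    using \<open>c > 0\<close> pos by (subst (asm) integrable_on_cmult_iff) auto
  define K where "K = integral {t0..} (\<lambda>s. aug_gap (x s))"
  have "gap (time_average t0 x t) \<le> K / (t - t0)" if "t > t0" for t
  proof -
    note gap_time_average[OF that]
    also have "integral {t0..t} (\<lambda>s. gap (x s)) \<le> integral {t0..t} (\<lambda>s. aug_gap (x s))"
      by (intro integral_le gap_le_aug_gap integrable_continuous_real
          continuous_on_subset[OF cont_gap] continuous_on_subset[OF cont_aug_gap]) auto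
    also have "\<dots> \<le> K"
      unfolding K_def by (intro integral_le_integral_ray int aug_gap_nonneg)
    finally show ?thesis
      using that by (simp add: pos_le_divide_eq mult.commute)
  qed
  then show "\<exists>K. \<forall>t>t0. gap (time_average t0 x t) \<le> K / (t - t0)"
    by blast
qed

text \<open>Here \<delta>\<beta> has derivative \<beta>, so the right-hand side of the dual equation
  is exactly the derivative of \<delta>\<beta> times the residual. The difference \<open>G\<close>
  is constant, and boundedness of \<open>l\<close> bounds the scaled residual.\<close>

lemma exponential_residual_rate:
  assumes "\<mu> > 0" and beta: "\<And>t. t \<ge> t0 \<Longrightarrow> \<beta> t = \<mu> * exp (t / \<delta>)"
  shows "\<exists>K. \<forall>t\<ge>t0. norm (residual (x t)) \<le> K / exp (t / \<delta>)"
proof -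
  define G where "G t = l t - (\<mu> * \<delta> * exp (t / \<delta>)) *\<^sub>R residual (x t)" for t
  have dG: "(G has_vector_derivative 0) (at s within {t0..})" if "s \<ge> t0" for s
  proof -
    have "((\<lambda>s. \<mu> * \<delta> * exp (s / \<delta>)) has_real_derivative \<mu> * exp (s / \<delta>)) (at s within {t0..})"
      using pos by (auto intro!: derivative_eq_intros)
    from has_vector_derivative_diff[OF dl[OF that]
        has_vector_derivative_scaleR[OF this dresidual[OF that]]]
    show ?thesis
      unfolding G_def by (simp add: dual[OF that] beta[OF that] algebra_simps)
  qed
  have "\<exists>k. \<forall>t\<ge>t0. G t = k"
  proof (rule has_vector_derivative_zero_constant[of "{t0..}" G])
    show "convex {t0..}"
      by (rule convex_real_interval)
    show "(G has_vector_derivative 0) (at s within {t0..})" if "s \<in> {t0..}" for s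
      using dG that by simp
  qed auto
  then obtain k where k: "G t = k" if "t \<ge> t0" for t
    by blast
  obtain B where B: "norm (l t - ls) \<le> B" if "t \<ge> t0" for t
    using trajectory_bound by blast
  have "norm (residual (x t)) \<le> (B + norm (ls - k)) / (\<mu> * \<delta>) / exp (t / \<delta>)" if "t \<ge> t0" for t
  proof -
    have "(\<mu> * \<delta> * exp (t / \<delta>)) *\<^sub>R residual (x t) = (l t - ls) + (ls - k)"
      using k[OF that] by (simp add: G_def algebra_simps)
    from arg_cong[OF this, of norm]
    have "\<mu> * \<delta> * exp (t / \<delta>) * norm (residual (x t)) = norm ((l t - ls) + (ls - k))"
      using assms(1) pos by (simp add: abs_mult)
    also have "\<dots> \<le> B + norm (ls - k)"
      using B[OF that] norm_triangle_ineq[of "l t - ls" "ls - k"] by linarith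
    finally show ?thesis
      using assms(1) pos by (simp add: field_simps)
  qed
  then show ?thesis
    by blast
qed

end

text \<open>Finiteness of an integral is expressed by absolute integrability; the three integrands
  are nonnegative on the ray. Differentiability everywhere makes \<open>f\<close> finite, hence
  real-valued.\<close>

theorem mainTheorem4:
  fixes t0 \<gamma> \<delta> \<sigma> :: real
    and A :: "real^'n^'m" and b :: "real^'m"
    and f :: "real^'n \<Rightarrow> real" and grad_f :: "real^'n \<Rightarrow> real^'n"
    and \<beta> \<beta>' :: "real \<Rightarrow> real"
    and \<epsilon> :: "real \<Rightarrow> real^'n"
    and x x' x'' :: "real \<Rightarrow> real^'n" and l l' :: "real \<Rightarrow> real^'m"
    and xs :: "real^'n" and ls :: "real^'m"
  assumes t0: "t0 \<ge> 0"
    and pos: "\<gamma> > 0" "\<delta> > 0" "\<sigma> > 0"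
    and convex: "convex_on UNIV f"
    and grad: "\<And>z. GDERIV f z :> grad_f z"
    and grad_cont: "continuous_on UNIV grad_f"
    and beta_pos: "\<And>t. t \<ge> t0 \<Longrightarrow> \<beta> t > 0"
    and beta_C1: "C1_on_ray t0 \<beta> \<beta>'"
    and beta_growth: "\<And>t. t \<ge> t0 \<Longrightarrow> \<beta>' t \<le> 1 / \<delta> * \<beta> t"
    and delta_gamma: "1 / \<delta> < \<gamma>"
    and eps: "\<epsilon> absolutely_integrable_on {t0..}"
    and sol: "global_solution t0 \<gamma> \<delta> \<sigma> grad_f A b \<beta> \<epsilon> x x' x'' l l'"
    and saddle: "(xs, ls) \<in> saddle_points f A b"
  shows
    "bounded ((\<lambda>t. (x t, l t)) ` {t0..}) \<and>
     (\<lambda>t. (1 / \<delta> * \<beta> t - \<beta>' t) *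
        (aug_lagrangian f A b \<sigma> (x t) ls - aug_lagrangian f A b \<sigma> xs (l t)))
       absolutely_integrable_on {t0..} \<and>
     (\<lambda>t. \<beta> t * (norm (A *v x t - b))\<^sup>2) absolutely_integrable_on {t0..} \<and>
     (\<lambda>t. (norm (x' t))\<^sup>2) absolutely_integrable_on {t0..} \<and>
     ((\<exists>c>0. \<forall>t\<ge>t0. \<beta> t = c) \<longrightarrow>
        (\<lambda>t. \<bar>f (time_average t0 x t) - f xs\<bar>) \<in> O[at_top](\<lambda>t. 1 / t) \<and>
        (\<lambda>t. norm (A *v time_average t0 x t - b)) \<in> O[at_top](\<lambda>t. 1 / t)) \<and>
     (filterlim \<beta> at_top at_top \<longrightarrow>
        (\<lambda>t. lagrangian f A b (x t) ls - lagrangian f A b xs (l t)) \<in> O[at_top](\<lambda>t. 1 / \<beta> t) \<and>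
        (\<lambda>t. norm (A *v x t - b)) \<in> O[at_top](\<lambda>t. 1 / sqrt (\<beta> t))) \<and>
     (\<forall>\<mu>>0. (\<forall>t\<ge>t0. \<beta> t = \<mu> * exp (t / \<delta>)) \<longrightarrow>
        (\<lambda>t. \<bar>f (x t) - f xs\<bar>) \<in> O[at_top](\<lambda>t. 1 / exp (t / \<delta>)) \<and>
        (\<lambda>t. norm (A *v x t - b)) \<in> O[at_top](\<lambda>t. 1 / exp (t / \<delta>)))"
proof -
  interpret perturbed_primal_dual_trajectory t0 \<gamma> \<delta> \<sigma> A b f grad_f \<beta> \<beta>' \<epsilon> x x' x'' l l' xs ls
    by unfold_locales (fact assms)+
  obtain K where K: "aug_gap (x t) \<le> K / \<beta> t" if "t \<ge> t0" for t
    using aug_gap_rate by blast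
  have gap_rate: "\<bar>gap (x t)\<bar> \<le> K * (1 / \<beta> t)" if "t \<ge> t0" for t
    using K[OF that] gap_nonneg[of "x t"] gap_le_aug_gap[of "x t"] by simp
  \<comment> \<open>The penalty part of \<open>aug_gap\<close> decays like
    \<open>1 / \<beta> t\<close>; it is quadratic in the residual, whence the square root.\<close>
  have residual_rate: "\<bar>norm (residual (x t))\<bar> \<le> sqrt (2 * K / \<sigma>) * (1 / sqrt (\<beta> t))"
    if "t \<ge> t0" for t
  proof -
    have "\<sigma> / 2 * (norm (residual (x t)))\<^sup>2 \<le> K / \<beta> t"
      using K[OF that] gap_nonneg[of "x t"] unfolding aug_gap_def by linarith
    then have "(norm (residual (x t)))\<^sup>2 \<le> 2 * K / \<sigma> / \<beta> t"
      using pos beta_pos[OF that] by (simp add: field_simps)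
    from real_le_rsqrt[OF this] show ?thesis
      by (simp add: real_sqrt_divide real_sqrt_mult)
  qed
  have ergodic: "(\<lambda>t. \<bar>f (time_average t0 x t) - f xs\<bar>) \<in> O[at_top](\<lambda>t. 1 / t) \<and>
      (\<lambda>t. norm (residual (time_average t0 x t))) \<in> O[at_top](\<lambda>t. 1 / t)"
    if const: "\<exists>c>0. \<forall>t\<ge>t0. \<beta> t = c"
  proof -
    obtain c where c: "c > 0" "\<And>t. t \<ge> t0 \<Longrightarrow> \<beta> t = c"
      using const by blast
    obtain K1 where K1: "norm (residual (time_average t0 x t)) \<le> K1 / (t - t0)" if "t > t0" for t
      using ergodic_rates(1)[OF c] by blast
    obtain K2 where K2: "gap (time_average t0 x t) \<le> K2 / (t - t0)" if "t > t0" for t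
      using ergodic_rates(2)[OF c] by blast
    have "\<bar>f (time_average t0 x t) - f xs\<bar> \<le> (K2 + norm ls * K1) / (t - t0)" if "t > t0" for t
      using objective_error[of "time_average t0 x t"] K2[OF that]
        mult_left_mono[OF K1[OF that] norm_ge_zero[of ls]]
      by (simp add: add_divide_distrib)
    then show ?thesis
      using K1 by (intro conjI bigo_inverse_of_shifted_bound[of t0]) auto
  qed
  have exponential: "(\<lambda>t. \<bar>f (x t) - f xs\<bar>) \<in> O[at_top](\<lambda>t. 1 / exp (t / \<delta>)) \<and>
      (\<lambda>t. norm (residual (x t))) \<in> O[at_top](\<lambda>t. 1 / exp (t / \<delta>))"
    if mu: "\<mu> > 0" and beta: "\<forall>t\<ge>t0. \<beta> t = \<mu> * exp (t / \<delta>)" for \<mu>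
  proof -
    obtain K1 where K1: "norm (residual (x t)) \<le> K1 / exp (t / \<delta>)" if "t \<ge> t0" for t
      using exponential_residual_rate[OF mu] beta by blast
    have "\<bar>f (x t) - f xs\<bar> \<le> (K / \<mu> + norm ls * K1) * (1 / exp (t / \<delta>))" if "t \<ge> t0" for t
    proof -
      \<comment> \<open>The general gap rate is already exponential for this \<beta>, so only
        feasibility required a separate argument.\<close>
      have "gap (x t) \<le> K / \<mu> / exp (t / \<delta>)"
        using gap_rate[OF that] beta that by simp
      then show ?thesis
        using objective_error[of "x t"] mult_left_mono[OF K1[OF that] norm_ge_zero[of ls]]
        by (simp add: add_divide_distrib)
    qed
    then show ?thesis
      using K1 by (intro conjI bigoI_ray[of t0 _ "K / \<mu> + norm ls * K1"] bigoI_ray[of t0 _ K1]) auto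
  qed
  show ?thesis
    unfolding aug_lagrangian_diff lagrangian_diff residual_def[symmetric]
    using trajectory_bounded aug_gap_integrable residual_integrable velocity_integrable
      ergodic exponential bigoI_ray[OF gap_rate] bigoI_ray[OF residual_rate]
    by (intro conjI impI allI) simp_all
qed

end
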